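(* Suppose $s\in[0,1]$. There exists a positive constant $C$ such that for all $n\ge 2$, \[ \sup_{x \in \mathbb{R}} \left| \frac{1}{P_n^{h_s}(1)} \sum_{k \le \mu_n(s) + x\, \sigma_n(s)} A_{n,k}(s) - \frac{1}{\sqrt{2\pi}} \int_{-\infty}^{x} e^{-t^2/2}\, dt \right| \le \frac{C}{\sigma_n(s)} . \] Moreover, $\sigma_n(s)\to\infty$ as $n\to\infty$.
   Context: For $s\in\mathbb{R}$ define polynomials $P_n^{h_s}(x)$ recursively by $P_0^{h_s}(x):=1$ and, for $n\ge 1$, $P_n^{h_s}(x) := \frac{x}{n^s}\sum_{k=0}^{n-1} P_k^{h_s}(x)$, and write $P_n^{h_s}(x)=\sum_{k=0}^n A_{n,k}(s)\,x^k$. Define $\mu_n(s) := 1+\sum_{k=1}^{n-1}\frac{1}{1+k^s}$ and $\sigma_n(s)\ge 0$ by $\sigma_n^2(s) := \sum_{k=1}^{n-1}\frac{k^s}{(1+k^s)^2}$. *)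

theory Defs
  imports "HOL-Probability.Probability" "HOL-Computational_Algebra.Polynomial"
begin

fun P_h :: "real \<Rightarrow> nat \<Rightarrow> real poly" where
  "P_h s n =
     (if n = 0 then 1
      else smult (1 / real n powr s) (monom 1 1 * (\<Sum>k<n. P_h s k)))"

declare P_h.simps [simp del]

lemma P_h_0: "P_h s 0 = 1"
  by (simp add: P_h.simps)

lemma poly_P_h:
  assumes "n \<ge> 1"
  shows "poly (P_h s n) x = x / real n powr s * (\<Sum>k=0..n-1. poly (P_h s k) x)"
proof -
  have "{0..n-1} = {..<n}"
    using assms by auto
  then show ?thesis
    using assms by (subst P_h.simps) (simp add: poly_sum poly_monom)
qed

definition A_coeff :: "nat \<Rightarrow> nat \<Rightarrow> real \<Rightarrow> real" where
  "A_coeff n k s = poly.coeff (P_h s n) k"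

lemma degree_P_h_le: "degree (P_h s n) \<le> n"
proof (induction n rule: less_induct)
  case (less n)
  show ?case
  proof (cases "n = 0")
    case True
    then show ?thesis by (simp add: P_h_0)
  next
    case False
    have "degree (\<Sum>k<n. P_h s k) \<le> n - 1"
      using less.IH by (intro degree_sum_le) fastforce+
    moreover have "degree (monom (1::real) 1 * (\<Sum>k<n. P_h s k))
        \<le> 1 + degree (\<Sum>k<n. P_h s k)"
      using degree_mult_le[of "monom (1::real) 1" "\<Sum>k<n. P_h s k"]
      by (simp add: degree_monom_eq)
    ultimately show ?thesis
      using False by (subst P_h.simps) simp
  qed
qed

lemma poly_P_h_eq_sum: "poly (P_h s n) x = (\<Sum>k=0..n. A_coeff n k s * x ^ k)"
proof -
  have "poly (P_h s n) x = (\<Sum>k\<le>degree (P_h s n). A_coeff n k s * x ^ k)"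
    by (simp add: poly_altdef A_coeff_def)
  also have "\<dots> = (\<Sum>k=0..n. A_coeff n k s * x ^ k)"
    using degree_P_h_le[of s n]
    by (intro sum.mono_neutral_left) (auto simp: A_coeff_def coeff_eq_0)
  finally show ?thesis .
qed

definition mu_h :: "nat \<Rightarrow> real \<Rightarrow> real" where
  "mu_h n s = 1 + (\<Sum>k=1..<n. 1 / (1 + real k powr s))"

definition sigma_h :: "nat \<Rightarrow> real \<Rightarrow> real" where
  "sigma_h n s = sqrt (\<Sum>k=1..<n. real k powr s / (1 + real k powr s)\<^sup>2)"

end

theory Submission
  imports Defs
begin

text \<open>
  Up to normalisation, \<open>P_n\<close> equals \<open>x\<close> times the product of the \<open>k^s + x\<close> for \<open>0 < k < n\<close>, so its
  coefficients are the law of \<open>1 + S\<close>, where \<open>S\<close> is a sum of independent Bernoulli variables with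
  parameters \<open>1 / (1 + k^s)\<close>. The Berry-Esseen bound for \<open>S\<close> is obtained by Stein's method: the
  zero-bias transform of \<open>S\<close> is within distance 1 of \<open>S\<close>, so in Stein's identity only the increments
  of \<open>w * f w\<close> over intervals of length \<open>1 / \<sigma>\<close> have to be estimated, and these are of order
  \<open>(1 + w\<^sup>2) / \<sigma>\<close>. Taking the threshold \<open>z\<close> of the Stein equation in the standardised lattice keeps the kink
  of its solution away from the interior of these intervals.
\<close>

section \<open>The Stein equation\<close>

abbreviation Phi :: "real \<Rightarrow> real" where
  "Phi \<equiv> cdf std_normal_distribution"

abbreviation phi :: "real \<Rightarrow> real" where
  "phi \<equiv> std_normal_density"

interpretation std_normal: real_distribution std_normal_distribution
  by (rule real_dist_normal_dist)

section \<open>The standard normal density and distribution function\<close>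

lemma integrable_std_normal_density: "integrable lborel phi"
  using integrable_std_normal_moment[of 0] by simp

lemma Phi_eq_integral: "Phi x = (LBINT t:{..x}. phi t)"
proof -
  have "Phi x = (\<integral>t. indicator {..x} t \<partial>std_normal_distribution)"
    by (simp add: cdf_def)
  also have "\<dots> = (\<integral>t. phi t * indicator {..x} t \<partial>lborel)"
    by (subst integral_density) auto
  finally show ?thesis
    by (simp add: set_lebesgue_integral_def mult.commute)
qed

lemma Phi_eq_exp_integral: "Phi x = 1 / sqrt (2 * pi) * (LBINT t:{..x}. exp (- (t\<^sup>2) / 2))"
  unfolding Phi_eq_integral set_lebesgue_integral_def
  by (subst integral_mult_right_zero[symmetric])
     (simp add: std_normal_density_def mult_ac)

lemma has_derivative_Phi: "(Phi has_real_derivative phi x) (at x)"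
proof -
  let ?a = "x - 1" and ?b = "x + 1"
  have cont: "continuous_on A phi" for A
    unfolding std_normal_density_def by (intro continuous_intros) auto
  have int: "set_integrable lborel A phi" if "A \<in> sets borel" for A
    using integrable_std_normal_density that unfolding set_integrable_def
    by (intro integrable_mult_indicator) auto
  \<comment> \<open>On a bounded window around \<open>x\<close>, \<open>Phi\<close> is a constant
    plus an integral over a compact interval, so the fundamental theorem of calculus
    applies.\<close>
  have eq: "Phi y = Phi ?a + integral {?a..y} phi" if "y \<in> {?a..?b}" for y
  proof -
    have "Phi y = (LBINT t:{..<?a} \<union> {?a..y}. phi t)"
      unfolding Phi_eq_integral using that
        by (intro arg_cong2[where f="\<lambda>A. set_lebesgue_integral lborel A"]) auto
    also have "\<dots> = (LBINT t:{..<?a}. phi t) + (LBINT t:{?a..y}. phi t)"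
      by (intro set_integral_Un int) auto
    also have "(LBINT t:{..<?a}. phi t) = Phi ?a"
      unfolding Phi_eq_integral
    proof (rule set_integral_null_delta)
      have "sym_diff {..<?a} {..?a} = {?a}" by auto
      then show "sym_diff {..<?a} {..?a} \<in> null_sets lborel"
        by (auto intro: countable_imp_null_set_lborel)
    qed (simp_all add: integrable_std_normal_density)
    also have "(LBINT t:{?a..y}. phi t) = integral {?a..y} phi"
      by (rule set_borel_integral_eq_integral(2)[OF int]) simp
    finally show ?thesis .
  qed
  have "((\<lambda>y. Phi ?a + integral {?a..y} phi) has_real_derivative phi x) (at x within {?a..?b})"
    by (rule DERIV_cong[OF DERIV_add[OF DERIV_const integral_has_real_derivative]])
       (auto intro: cont)
  then have "(Phi has_real_derivative phi x) (at x within {?a..?b})"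
    by (rule has_field_derivative_transform_within[where d=1]) (simp_all add: eq[symmetric])
  then show ?thesis
    by (subst (asm) at_within_interior) auto
qed

lemma has_derivative_std_normal_density: "(phi has_real_derivative - x * phi x) (at x)"
  unfolding std_normal_density_def by (rule derivative_eq_intros refl | simp)+

lemma std_normal_density_pos: "phi x > 0"
  by (rule normal_density_pos) simp

lemma Phi_bounds: "0 \<le> Phi x" "Phi x \<le> 1"
  by (rule std_normal.cdf_nonneg, rule std_normal.cdf_bounded_prob)

lemma std_normal_density_le_1: "phi x \<le> 1"
proof -
  have "1 \<le> sqrt (2 * pi)"
    using pi_gt3 by (intro real_le_rsqrt) auto
  then have "1 / sqrt (2 * pi) * exp (- x\<^sup>2 / 2) \<le> 1 * 1"
    by (intro mult_mono) auto
  then show ?thesis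
    by (simp add: std_normal_density_def)
qed

text \<open>By the mean value theorem, as the density is at most 1. This is the cost of moving a
  threshold to the lattice.\<close>

lemma Phi_diff_le:
  assumes "x \<le> y"
  shows "Phi y - Phi x \<le> y - x"
proof (cases "x = y")
  case False
  then obtain c where "Phi y - Phi x = (y - x) * phi c"
    using MVT2[of x y Phi phi] has_derivative_Phi assms by force
  then show ?thesis
    using std_normal_density_le_1[of c] assms by (simp add: mult_left_le)
qed auto

text \<open>Both Mills bounds come from \<open>t \<mapsto> phi t + w * Phi t\<close>, whose derivative \<open>(w - t) * phi t\<close>
  changes sign at \<open>t = w\<close>.\<close>

lemma has_derivative_mills:
  "((\<lambda>t. phi t + w * Phi t) has_real_derivative (w - t) * phi t) (at t)"
  by (auto intro!: derivative_eq_intros has_derivative_Phi has_derivative_std_normal_density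
      simp: algebra_simps)

lemma mills_lower: "- w * Phi w \<le> phi w"
proof -
  have "w * Phi a \<le> phi w + w * Phi w" if "a \<le> w" for a
  proof -
    have "phi a + w * Phi a \<le> phi w + w * Phi w"
      by (rule DERIV_nonneg_imp_nondecreasing[OF that])
         (use has_derivative_mills std_normal_density_pos in
           \<open>force intro: mult_nonneg_nonneg less_imp_le\<close>)
    then show ?thesis
      using std_normal_density_pos[of a] by simp
  qed
  \<comment> \<open>The right side is free of \<open>a\<close>; as \<open>a\<close> tends to minus
    infinity, the left side tends to 0.\<close>
  then have "eventually (\<lambda>a. w * Phi a \<le> phi w + w * Phi w) at_bot"
    unfolding eventually_at_bot_linorder by blast
  moreover have "((\<lambda>a. w * Phi a) \<longlongrightarrow> w * 0) at_bot"
    by (intro tendsto_intros std_normal.cdf_lim_at_bot)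
  ultimately have "w * 0 \<le> phi w + w * Phi w"
    by (intro tendsto_upperbound) auto
  then show ?thesis by simp
qed

lemma mills_upper: "w * (1 - Phi w) \<le> phi w"
proof -
  have "w * Phi b \<le> phi w + w * Phi w" if "w \<le> b" for b
  proof -
    have "phi b + w * Phi b \<le> phi w + w * Phi w"
      by (rule DERIV_nonpos_imp_nonincreasing[OF that])
         (use has_derivative_mills std_normal_density_pos in
           \<open>force intro: mult_nonpos_nonneg less_imp_le\<close>)
    then show ?thesis
      using std_normal_density_pos[of b] by simp
  qed
  then have "eventually (\<lambda>b. w * Phi b \<le> phi w + w * Phi w) at_top"
    unfolding eventually_at_top_linorder by blast
  moreover have "((\<lambda>b. w * Phi b) \<longlongrightarrow> w * 1) at_top"
    by (intro tendsto_intros std_normal.cdf_lim_at_top_prob)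
  ultimately have "w * 1 \<le> phi w + w * Phi w"
    by (intro tendsto_upperbound) auto
  then show ?thesis by (simp add: algebra_simps)
qed

text \<open>The bounded solution of Stein's equation \<open>f' w - w * f w = of_bool (w \<le> z) - Phi z\<close>.\<close>

definition stein_sol :: "real \<Rightarrow> real \<Rightarrow> real" where
  "stein_sol z w = (if w \<le> z then Phi w * (1 - Phi z) else Phi z * (1 - Phi w)) / phi w"

section \<open>Bounds on the Stein solution and its increments\<close>

lemma stein_sol_nonneg: "0 \<le> stein_sol z w"
  unfolding stein_sol_def using Phi_bounds std_normal_density_pos[of w]
  by (auto intro!: divide_nonneg_pos mult_nonneg_nonneg)

text \<open>In either branch, monotonicity of \<open>Phi\<close> lets \<open>w\<close> replace
  \<open>z\<close>, which gives an envelope free of \<open>z\<close>.\<close>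

lemma stein_sol_le: "stein_sol z w \<le> Phi w * (1 - Phi w) / phi w"
proof -
  have "Phi w \<le> Phi z" if "w \<le> z"
    using that by (rule std_normal.cdf_nondecreasing)
  moreover have "Phi z \<le> Phi w" if "z \<le> w"
    using that by (rule std_normal.cdf_nondecreasing)
  ultimately have "(if w \<le> z then Phi w * (1 - Phi z) else Phi z * (1 - Phi w)) \<le> Phi w * (1 - Phi w)"
    using Phi_bounds by (auto intro: mult_left_mono mult_right_mono)
  then show ?thesis
    unfolding stein_sol_def using std_normal_density_pos[of w] by (intro divide_right_mono) auto
qed

text \<open>The envelope reduces this to the Mills bounds, after dropping the factor
  \<open>Phi w\<close> for nonnegative \<open>w\<close> and \<open>1 - Phi w\<close> for negative
  \<open>w\<close>.\<close>

lemma abs_mult_stein_sol_le: "\<bar>w * stein_sol z w\<bar> \<le> 1"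
proof -
  have "\<bar>w\<bar> * (Phi w * (1 - Phi w)) \<le> phi w"
  proof (cases "w \<ge> 0")
    case True
    then have "\<bar>w\<bar> * (Phi w * (1 - Phi w)) = Phi w * (w * (1 - Phi w))" by simp
    also have "\<dots> \<le> 1 * (w * (1 - Phi w))"
      using True Phi_bounds[of w] by (intro mult_right_mono) auto
    finally show ?thesis using mills_upper[of w] by simp
  next
    case False
    then have "\<bar>w\<bar> * (Phi w * (1 - Phi w)) = (- w * Phi w) * (1 - Phi w)" by simp
    also have "\<dots> \<le> (- w * Phi w) * 1"
      using False Phi_bounds[of w] by (intro mult_left_mono) (auto intro: mult_nonpos_nonneg)
    finally show ?thesis using mills_lower[of w] by simp
  qed
  then have "\<bar>w\<bar> * (Phi w * (1 - Phi w) / phi w) \<le> 1"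
    using std_normal_density_pos[of w] by (simp add: field_simps)
  moreover have "\<bar>w\<bar> * stein_sol z w \<le> \<bar>w\<bar> * (Phi w * (1 - Phi w) / phi w)"
    by (intro mult_left_mono stein_sol_le) auto
  ultimately show ?thesis
    using stein_sol_nonneg[of z w] by (simp add: abs_mult)
qed

text \<open>Where \<open>\<bar>w\<bar> \<le> 1\<close>, the envelope has numerator at most 1 and
  \<open>phi w\<close> is at least \<open>phi 1\<close>; elsewhere the bound on
  \<open>w * stein_sol z w\<close> suffices.\<close>

lemma stein_sol_bounded: "stein_sol z w \<le> 1 / phi 1"
proof (cases "\<bar>w\<bar> \<le> 1")
  case True
  have "Phi w * (1 - Phi w) \<le> 1 * 1"
    using Phi_bounds[of w] by (intro mult_mono) auto
  moreover have "phi 1 \<le> phi w"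
    using True by (auto simp: std_normal_density_def abs_square_le_1 intro!: divide_right_mono)
  ultimately have "Phi w * (1 - Phi w) / phi w \<le> 1 / phi 1"
    using std_normal_density_pos[of 1] by (intro frac_le) auto
  then show ?thesis
    using stein_sol_le[of z w] by simp
next
  case False
  then have "1 * stein_sol z w \<le> \<bar>w\<bar> * stein_sol z w"
    by (intro mult_right_mono stein_sol_nonneg) auto
  also have "\<dots> \<le> 1"
    using abs_mult_stein_sol_le[of w z] stein_sol_nonneg[of z w] by (simp add: abs_mult)
  also have "1 \<le> 1 / phi 1"
    using std_normal_density_pos[of 1] std_normal_density_le_1[of 1] by simp
  finally show ?thesis by simp
qed

text \<open>As \<open>phi\<close> has derivative \<open>- w * phi w\<close>, dividing by it creates
  the term \<open>w * f w\<close> of Stein's equation; this serves both branches of the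
  solution.\<close>

lemma has_derivative_quotient_phi:
  assumes "(g has_real_derivative c * phi w) (at w)"
  shows "((\<lambda>w. g w / phi w) has_real_derivative w * (g w / phi w) + c) (at w)"
proof -
  have "(d * q - v * (- w * q)) / (q * q) = w * (v / q) + d / q" if "q \<noteq> 0" for d q v :: real
    using that by (simp add: field_simps)
  from DERIV_cong[OF DERIV_divide[OF assms has_derivative_std_normal_density] this]
  show ?thesis
    using std_normal_density_pos[of w] by simp
qed

text \<open>On each side of \<open>z\<close> the solution is a smooth branch, so the mean value
  theorem applies unless the kink is interior. The indicator is constant on the interval open at
  \<open>a\<close> and closed at \<open>b\<close>, so it can be read at \<open>b\<close> instead of
  \<open>c\<close>.\<close>

lemma stein_sol_mvt:
  assumes "a < b" and "b \<le> z \<or> z \<le> a"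
  obtains c where "a < c" "c < b"
    "stein_sol z b - stein_sol z a = (b - a) * (c * stein_sol z c + of_bool (b \<le> z) - Phi z)"
proof (cases "b \<le> z")
  case True
  have "((\<lambda>w. Phi w * (1 - Phi z) / phi w) has_real_derivative
          w * (Phi w * (1 - Phi z) / phi w) + (1 - Phi z)) (at w)" for w
    by (rule has_derivative_quotient_phi)
       (rule DERIV_cong[OF DERIV_cmult_right[OF has_derivative_Phi]], rule mult.commute)
  then obtain c where c: "a < c" "c < b"
    "Phi b * (1 - Phi z) / phi b - Phi a * (1 - Phi z) / phi a
      = (b - a) * (c * (Phi c * (1 - Phi z) / phi c) + (1 - Phi z))"
    using MVT2[OF \<open>a < b\<close>, of "\<lambda>w. Phi w * (1 - Phi z) / phi w"
        "\<lambda>w. w * (Phi w * (1 - Phi z) / phi w) + (1 - Phi z)"] by blast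
  show ?thesis
  proof (rule that[OF c(1,2)])
    have "stein_sol z w = Phi w * (1 - Phi z) / phi w" if "w \<le> z" for w
      using that by (simp add: stein_sol_def)
    then have "stein_sol z b = Phi b * (1 - Phi z) / phi b" "stein_sol z a = Phi a * (1 - Phi z) / phi a"
        "stein_sol z c = Phi c * (1 - Phi z) / phi c"
      using c(1,2) True by simp_all
    then show "stein_sol z b - stein_sol z a = (b - a) * (c * stein_sol z c + of_bool (b \<le> z) - Phi z)"
      using c(3) True by (simp only: of_bool_eq simp_thms add_diff_eq)
  qed
next
  case False
  then have "z \<le> a" using assms by simp
  \<comment> \<open>The branches agree at \<open>z\<close>, so \<open>w = z\<close> is
    included.\<close>
  have eq: "stein_sol z w = Phi z * (1 - Phi w) / phi w" if "z \<le> w" for w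
    using that by (auto simp: stein_sol_def)
  have "((\<lambda>w. Phi z * (1 - Phi w) / phi w) has_real_derivative
          w * (Phi z * (1 - Phi w) / phi w) - Phi z) (at w)" for w
  proof -
    have "((\<lambda>w. Phi z * (1 - Phi w)) has_real_derivative (- Phi z) * phi w) (at w)"
      by (rule DERIV_cong[OF DERIV_cmult[OF DERIV_diff[OF DERIV_const has_derivative_Phi]]]) simp
    then show ?thesis
      using has_derivative_quotient_phi by fastforce
  qed
  then obtain c where c: "a < c" "c < b"
    "Phi z * (1 - Phi b) / phi b - Phi z * (1 - Phi a) / phi a
      = (b - a) * (c * (Phi z * (1 - Phi c) / phi c) - Phi z)"
    using MVT2[OF \<open>a < b\<close>, of "\<lambda>w. Phi z * (1 - Phi w) / phi w"
        "\<lambda>w. w * (Phi z * (1 - Phi w) / phi w) - Phi z"] by blast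
  show ?thesis
  proof (rule that[OF c(1,2)])
    have "stein_sol z b = Phi z * (1 - Phi b) / phi b" "stein_sol z a = Phi z * (1 - Phi a) / phi a"
        "stein_sol z c = Phi z * (1 - Phi c) / phi c"
      using c(1,2) \<open>z \<le> a\<close> \<open>a < b\<close> by (intro eq; linarith)+
    then show "stein_sol z b - stein_sol z a = (b - a) * (c * stein_sol z c + of_bool (b \<le> z) - Phi z)"
      using c(3) False by (simp only: of_bool_eq simp_thms add_0_right)
  qed
qed

text \<open>The derivative is \<open>c * stein_sol z c\<close> plus \<open>1 - Phi z\<close> or
  \<open>- Phi z\<close>; both summands have modulus at most 1.\<close>

lemma stein_sol_lipschitz:
  assumes "x \<le> z \<and> y \<le> z \<or> z \<le> x \<and> z \<le> y"
  shows "\<bar>stein_sol z x - stein_sol z y\<bar> \<le> 2 * \<bar>x - y\<bar>"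
proof -
  have *: "\<bar>stein_sol z b - stein_sol z a\<bar> \<le> 2 * (b - a)" if ab: "a < b" "b \<le> z \<or> z \<le> a" for a b
  proof -
    obtain c where "a < c" "c < b" and c:
      "stein_sol z b - stein_sol z a = (b - a) * (c * stein_sol z c + of_bool (b \<le> z) - Phi z)"
      by (rule stein_sol_mvt[OF ab])
    have "\<bar>c * stein_sol z c\<bar> \<le> 1" "0 \<le> Phi z" "Phi z \<le> 1"
      by (rule abs_mult_stein_sol_le Phi_bounds)+
    then have "\<bar>c * stein_sol z c + of_bool (b \<le> z) - Phi z\<bar> \<le> 2"
      by (cases "b \<le> z") (simp_all add: abs_le_iff)
    then have "(b - a) * \<bar>c * stein_sol z c + of_bool (b \<le> z) - Phi z\<bar> \<le> (b - a) * 2"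
      using ab by (intro mult_left_mono) simp_all
    then show ?thesis
      unfolding c abs_mult using ab by simp
  qed
  show ?thesis
    using *[of x y] *[of y x] assms by (cases x y rule: linorder_cases) (auto simp: abs_minus_commute)
qed

text \<open>A discrete product rule. Bounding by a quadratic in \<open>y\<close> alone lets the
  expectation at a lattice point \<open>y\<close> be controlled by the variance.\<close>

lemma mult_stein_sol_diff_le:
  assumes "x \<le> z \<and> y \<le> z \<or> z \<le> x \<and> z \<le> y"
  shows "\<bar>x * stein_sol z x - y * stein_sol z y\<bar> \<le> \<bar>x - y\<bar> * (1 + y\<^sup>2 + 1 / phi 1)"
proof -
  have "x * stein_sol z x - y * stein_sol z y
      = y * (stein_sol z x - stein_sol z y) + (x - y) * stein_sol z x"
    by (simp add: algebra_simps)
  also have "\<bar>\<dots>\<bar> \<le> \<bar>y\<bar> * \<bar>stein_sol z x - stein_sol z y\<bar> + \<bar>x - y\<bar> * \<bar>stein_sol z x\<bar>"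
    by (metis abs_mult abs_triangle_ineq)
  also have "\<dots> \<le> \<bar>y\<bar> * (2 * \<bar>x - y\<bar>) + \<bar>x - y\<bar> * (1 / phi 1)"
    using stein_sol_lipschitz[OF assms] stein_sol_bounded[of z x] stein_sol_nonneg[of z x]
    by (intro add_mono mult_left_mono) auto
  also have "\<dots> = \<bar>x - y\<bar> * (2 * \<bar>y\<bar> + 1 / phi 1)"
    by (simp add: algebra_simps)
  also have "\<dots> \<le> \<bar>x - y\<bar> * (1 + y\<^sup>2 + 1 / phi 1)"
  proof -
    have "0 \<le> (\<bar>y\<bar> - 1)\<^sup>2" by simp
    then have "2 * \<bar>y\<bar> \<le> 1 + y\<^sup>2"
      unfolding power2_diff by simp
    then show ?thesis by (intro mult_left_mono) auto
  qed
  finally show ?thesis .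
qed

section \<open>Poisson binomial distributions\<close>

text \<open>The expectation of \<open>F S\<close>, where \<open>S\<close> is a sum of independent Bernoulli variables with
  parameters \<open>p 0, \<dots>, p (n - 1)\<close>.\<close>

primrec pb_expect :: "(nat \<Rightarrow> real) \<Rightarrow> nat \<Rightarrow> (nat \<Rightarrow> real) \<Rightarrow> real" where
  "pb_expect p 0 F = F 0"
| "pb_expect p (Suc n) F = (1 - p n) * pb_expect p n F + p n * pb_expect p n (\<lambda>k. F (Suc k))"

lemma pb_expect_add: "pb_expect p n (\<lambda>k. F k + G k) = pb_expect p n F + pb_expect p n G"
  by (induction n arbitrary: F G) (simp_all add: algebra_simps)

lemma pb_expect_cmult: "pb_expect p n (\<lambda>k. c * F k) = c * pb_expect p n F"
  by (induction n arbitrary: F) (simp_all add: algebra_simps)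

lemma pb_expect_const: "pb_expect p n (\<lambda>k. c) = c"
  by (induction n) (simp_all add: algebra_simps)

lemma pb_expect_sum: "pb_expect p n (\<lambda>k. \<Sum>i\<in>A. F i k) = (\<Sum>i\<in>A. pb_expect p n (F i))"
  by (induction A rule: infinite_finite_induct) (simp_all add: pb_expect_add pb_expect_const)

lemma pb_expect_mono:
  assumes "\<And>i. 0 \<le> p i \<and> p i \<le> 1" and "\<And>k. F k \<le> G k"
  shows "pb_expect p n F \<le> pb_expect p n G"
  using assms(2)
proof (induction n arbitrary: F G)
  case (Suc n)
  then show ?case
    using assms(1)[of n] by (auto intro!: add_mono mult_left_mono)
qed auto

text \<open>The zero-bias transform of a Poisson binomial variable \<open>S\<close> lies between \<open>S - 1\<close> and \<open>S + 1\<close>.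
  Hence the covariance of \<open>S\<close> and \<open>F S\<close> is controlled by any majorant of both the
  forward and the backward difference of \<open>F\<close>.\<close>

lemma pb_expect_zero_bias:
  assumes p: "\<And>i. 0 \<le> p i \<and> p i \<le> 1"
    and "\<And>k. F (Suc k) - F k \<le> M k" and "\<And>k. F (Suc k) - F k \<le> M (Suc k)"
  shows "pb_expect p n (\<lambda>k. (real k - (\<Sum>i<n. p i)) * F k)
    \<le> (\<Sum>i<n. p i * (1 - p i)) * pb_expect p n M"
  using assms(2,3)
proof (induction n arbitrary: F M)
  case (Suc n)
  define q where "q = p n"
  define m where "m = (\<Sum>i<n. p i)"
  \<comment> \<open>\<open>F'\<close> and \<open>M'\<close> are \<open>F\<close> and
    \<open>M\<close> averaged over the last Bernoulli variable.\<close>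
  define F' where "F' = (\<lambda>k. (1 - q) * F k + q * F (Suc k))"
  define M' where "M' = (\<lambda>k. (1 - q) * M k + q * M (Suc k))"
  have q: "0 \<le> q" "q \<le> 1" using p[of n] by (auto simp: q_def)
  have M': "pb_expect p n M' = pb_expect p (Suc n) M"
    unfolding M'_def pb_expect_add pb_expect_cmult by (simp add: q_def)
  \<comment> \<open>The majorant at \<open>k\<close> gets weight \<open>1 - q\<close>, the one at
    \<open>Suc k\<close> weight \<open>q\<close>.\<close>
  have dF: "F (Suc k) - F k \<le> M' k" for k
  proof -
    have "F (Suc k) - F k = (1 - q) * (F (Suc k) - F k) + q * (F (Suc k) - F k)"
      by (simp add: algebra_simps)
    also have "\<dots> \<le> M' k"
      unfolding M'_def using q Suc.prems by (intro add_mono mult_left_mono) auto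
    finally show ?thesis .
  qed
  have "pb_expect p (Suc n) (\<lambda>k. (real k - (\<Sum>i<Suc n. p i)) * F k)
      = pb_expect p n (\<lambda>k. (1 - q) * ((real k - (m + q)) * F k)
          + q * ((real (Suc k) - (m + q)) * F (Suc k)))"
    unfolding pb_expect_add pb_expect_cmult by (simp add: m_def q_def)
  \<comment> \<open>Centring the last variable leaves its variance \<open>q * (1 - q)\<close> times
    the forward difference.\<close>
  also have "\<dots> = pb_expect p n (\<lambda>k. (real k - m) * F' k + (q * (1 - q)) * (F (Suc k) - F k))"
    by (rule arg_cong[where f="pb_expect p n"]) (simp add: F'_def algebra_simps fun_eq_iff)
  also have "\<dots> = pb_expect p n (\<lambda>k. (real k - m) * F' k)
      + (q * (1 - q)) * pb_expect p n (\<lambda>k. F (Suc k) - F k)"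
    unfolding pb_expect_add pb_expect_cmult ..
  finally have step: "pb_expect p (Suc n) (\<lambda>k. (real k - (\<Sum>i<Suc n. p i)) * F k)
      = pb_expect p n (\<lambda>k. (real k - m) * F' k) + (q * (1 - q)) * pb_expect p n (\<lambda>k. F (Suc k) - F k)" .
  have IH: "pb_expect p n (\<lambda>k. (real k - m) * F' k) \<le> (\<Sum>i<n. p i * (1 - p i)) * pb_expect p n M'"
    unfolding m_def
  proof (rule Suc.IH)
    fix k
    have eq: "F' (Suc k) - F' k
        = (1 - q) * (F (Suc k) - F k) + q * (F (Suc (Suc k)) - F (Suc k))"
      by (simp add: F'_def algebra_simps)
    show "F' (Suc k) - F' k \<le> M' k" "F' (Suc k) - F' k \<le> M' (Suc k)"
      unfolding eq M'_def using q Suc.prems by (auto intro!: add_mono mult_left_mono)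
  qed
  have "(q * (1 - q)) * pb_expect p n (\<lambda>k. F (Suc k) - F k) \<le> (q * (1 - q)) * pb_expect p n M'"
    using q by (intro mult_left_mono pb_expect_mono[OF p dF]) auto
  then have "pb_expect p (Suc n) (\<lambda>k. (real k - (\<Sum>i<Suc n. p i)) * F k)
      \<le> (\<Sum>i<n. p i * (1 - p i)) * pb_expect p n M' + (q * (1 - q)) * pb_expect p n M'"
    unfolding step using IH by (rule add_mono[rotated])
  also have "\<dots> = (\<Sum>i<Suc n. p i * (1 - p i)) * pb_expect p (Suc n) M"
    unfolding M' by (simp add: q_def distrib_right del: pb_expect.simps)
  finally show ?case .
qed auto

text \<open>The zero-bias bound for the centred identity, whose increments are all 1.\<close>

lemma pb_expect_variance_le:
  assumes "\<And>i. 0 \<le> p i \<and> p i \<le> 1"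
  shows "pb_expect p n (\<lambda>k. (real k - (\<Sum>i<n. p i))\<^sup>2) \<le> (\<Sum>i<n. p i * (1 - p i))"
  using pb_expect_zero_bias[OF assms, where n=n and F="\<lambda>k. real k - (\<Sum>i<n. p i)" and M="\<lambda>_. 1"]
  by (simp add: pb_expect_const power2_eq_square)

lemma pb_lattice_comparison:
  fixes m :: int
  assumes p: "\<And>i. 0 \<le> p i \<and> p i \<le> 1"
    and \<mu>: "\<mu> = (\<Sum>i<n. p i)" and \<sigma>: "\<sigma>\<^sup>2 = (\<Sum>i<n. p i * (1 - p i))" "\<sigma> > 0"
  shows "Phi ((of_int m - \<mu>) / \<sigma>) \<le> pb_expect p n (\<lambda>k. of_bool (int k \<le> m)) + (2 + 1 / phi 1) / \<sigma>"
    and "pb_expect p n (\<lambda>k. of_bool (int k \<le> m - 1)) \<le> Phi ((of_int m - \<mu>) / \<sigma>) + (2 + 1 / phi 1) / \<sigma>"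
proof -
  define z where "z = (of_int m - \<mu>) / \<sigma>"
  define w where "w = (\<lambda>k::nat. (real k - \<mu>) / \<sigma>)"
  define f where "f = stein_sol z"
  define R where "R = (\<lambda>k. (1 + (w k)\<^sup>2 + 1 / phi 1) / \<sigma>)"
  have w_Suc: "w (Suc k) - w k = 1 / \<sigma>" for k
    by (simp add: w_def diff_divide_distrib add_divide_distrib)
  have le_z: "w k \<le> z \<longleftrightarrow> int k \<le> m" for k
    unfolding w_def z_def using \<sigma>(2)
    by (simp add: divide_le_cancel) (metis of_int_le_iff of_int_of_nat_eq)
  have ge_z: "z \<le> w k \<longleftrightarrow> m \<le> int k" for k
    unfolding w_def z_def using \<sigma>(2)
    by (simp add: divide_le_cancel) (metis of_int_le_iff of_int_of_nat_eq)
  have key: "\<exists>d. f (w (Suc k)) - f (w k) = (d + of_bool (int (Suc k) \<le> m) - Phi z) / \<sigma>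
      \<and> \<bar>d - w k * f (w k)\<bar> \<le> R k \<and> \<bar>d - w (Suc k) * f (w (Suc k))\<bar> \<le> R (Suc k)" for k
  proof -
    have lt: "w k < w (Suc k)"
      using w_Suc[of k] \<sigma>(2) by (smt (verit) divide_pos_pos)
    \<comment> \<open>No integer \<open>m\<close> lies strictly between \<open>k\<close> and
      \<open>Suc k\<close>, so the kink is never interior.\<close>
    have side: "w (Suc k) \<le> z \<or> z \<le> w k"
      unfolding le_z ge_z by linarith
    obtain c where c: "w k < c" "c < w (Suc k)"
      "f (w (Suc k)) - f (w k) = (w (Suc k) - w k) * (c * f c + of_bool (w (Suc k) \<le> z) - Phi z)"
      unfolding f_def by (rule stein_sol_mvt[OF lt side])
    have bound: "\<bar>c * f c - y * f y\<bar> \<le> (1 + y\<^sup>2 + 1 / phi 1) / \<sigma>"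
      if "y = w k \<or> y = w (Suc k)" for y
    proof -
      have "\<bar>c * f c - y * f y\<bar> \<le> \<bar>c - y\<bar> * (1 + y\<^sup>2 + 1 / phi 1)"
        unfolding f_def by (rule mult_stein_sol_diff_le) (use that side c in auto)
      also have "\<dots> \<le> 1 / \<sigma> * (1 + y\<^sup>2 + 1 / phi 1)"
        using that c w_Suc[of k] std_normal_density_pos[of 1] by (intro mult_right_mono) auto
      finally show ?thesis by simp
    qed
    show ?thesis
      by (rule exI[of _ "c * f c"])
        (use c(3) bound[of "w k"] bound[of "w (Suc k)"] in \<open>simp add: w_Suc R_def le_z\<close>)
  qed
  \<comment> \<open>The mean of \<open>(w k)\<^sup>2\<close> is at most 1, which raises
    \<open>1 + 1 / phi 1\<close> to \<open>2 + 1 / phi 1\<close>.\<close>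
  have ER: "pb_expect p n R \<le> (2 + 1 / phi 1) / \<sigma>"
  proof -
    have "pb_expect p n R
        = pb_expect p n (\<lambda>k. (1 + 1 / phi 1) / \<sigma> + 1 / \<sigma> ^ 3 * (real k - \<mu>)\<^sup>2)"
      using \<sigma>(2) by (intro arg_cong[where f="pb_expect p n"] ext)
        (simp add: R_def w_def field_simps power2_eq_square power3_eq_cube)
    also have "\<dots> \<le> (1 + 1 / phi 1) / \<sigma> + 1 / \<sigma> ^ 3 * \<sigma>\<^sup>2"
      unfolding pb_expect_add pb_expect_cmult pb_expect_const \<mu> \<sigma>(1) using \<sigma>(2)
      by (intro add_mono mult_left_mono pb_expect_variance_le p) auto
    also have "\<dots> = (2 + 1 / phi 1) / \<sigma>"
      using \<sigma>(2) by (simp add: field_simps power2_eq_square power3_eq_cube)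
    finally show ?thesis .
  qed
  \<comment> \<open>The same term arises from \<open>\<sigma>\<^sup>2\<close> times the expectation
    of \<open>M\<close> below and cancels, leaving \<open>Phi z\<close>, the indicator and the error
    \<open>R\<close>.\<close>
  have cov: "pb_expect p n (\<lambda>k. (real k - \<mu>) * f (w k)) = \<sigma> * pb_expect p n (\<lambda>k. w k * f (w k))"
    unfolding pb_expect_cmult[symmetric] using \<sigma>(2) by (simp add: w_def)
  show "Phi ((of_int m - \<mu>) / \<sigma>) \<le> pb_expect p n (\<lambda>k. of_bool (int k \<le> m)) + (2 + 1 / phi 1) / \<sigma>"
  proof -
    \<comment> \<open>The increment carries the indicator of \<open>int (Suc k) \<le> m\<close>;
      that of \<open>int k \<le> m\<close> majorises it at both \<open>k\<close> and
      \<open>Suc k\<close>.\<close>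
    define M where "M = (\<lambda>k. 1 / \<sigma> * (w k * f (w k) + R k + of_bool (int k \<le> m) + (- Phi z)))"
    have "pb_expect p n (\<lambda>k. (real k - \<mu>) * f (w k)) \<le> \<sigma>\<^sup>2 * pb_expect p n M"
      unfolding \<mu> \<sigma>(1)
    proof (rule pb_expect_zero_bias[OF p])
      fix k
      obtain d where d: "f (w (Suc k)) - f (w k) = (d + of_bool (int (Suc k) \<le> m) - Phi z) / \<sigma>"
        "\<bar>d - w k * f (w k)\<bar> \<le> R k" "\<bar>d - w (Suc k) * f (w (Suc k))\<bar> \<le> R (Suc k)"
        using key[of k] by blast
      show "f (w (Suc k)) - f (w k) \<le> M k" "f (w (Suc k)) - f (w k) \<le> M (Suc k)"
        unfolding d(1) M_def using d(2,3) \<sigma>(2)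
        by (auto intro!: divide_right_mono simp: of_bool_def)
    qed
    also have "\<dots> = \<sigma> * (pb_expect p n (\<lambda>k. w k * f (w k)) + pb_expect p n R
        + pb_expect p n (\<lambda>k. of_bool (int k \<le> m)) - Phi z)"
      unfolding M_def pb_expect_cmult pb_expect_add pb_expect_const using \<sigma>(2)
      by (simp add: power2_eq_square)
    finally show ?thesis
      using ER \<sigma>(2) unfolding cov z_def by simp
  qed
  show "pb_expect p n (\<lambda>k. of_bool (int k \<le> m - 1)) \<le> Phi ((of_int m - \<mu>) / \<sigma>) + (2 + 1 / phi 1) / \<sigma>"
  proof -
    \<comment> \<open>For \<open>- f\<close> the indicator enters negatively and must be minorised
      at \<open>k\<close> and \<open>Suc k\<close>, hence the threshold
      \<open>m - 1\<close>.\<close>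
    define M where "M = (\<lambda>k. 1 / \<sigma> * ((-1) * (w k * f (w k)) + R k
      + (-1) * of_bool (int k \<le> m - 1) + Phi z))"
    have "pb_expect p n (\<lambda>k. (real k - \<mu>) * (- f (w k))) \<le> \<sigma>\<^sup>2 * pb_expect p n M"
      unfolding \<mu> \<sigma>(1)
    proof (rule pb_expect_zero_bias[OF p])
      fix k
      obtain d where d: "f (w (Suc k)) - f (w k) = (d + of_bool (int (Suc k) \<le> m) - Phi z) / \<sigma>"
        "\<bar>d - w k * f (w k)\<bar> \<le> R k" "\<bar>d - w (Suc k) * f (w (Suc k))\<bar> \<le> R (Suc k)"
        using key[of k] by blast
      have d': "- f (w (Suc k)) - - f (w k) = (Phi z - d - of_bool (int (Suc k) \<le> m)) / \<sigma>"
        using d(1) by (simp add: diff_divide_distrib add_divide_distrib)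
      show "- f (w (Suc k)) - - f (w k) \<le> M k" "- f (w (Suc k)) - - f (w k) \<le> M (Suc k)"
        unfolding d' M_def using d(2,3) \<sigma>(2)
        by (auto intro!: divide_right_mono simp: of_bool_def)
    qed
    also have "\<dots> = \<sigma> * (- pb_expect p n (\<lambda>k. w k * f (w k)) + pb_expect p n R
        - pb_expect p n (\<lambda>k. of_bool (int k \<le> m - 1)) + Phi z)"
      unfolding M_def pb_expect_cmult pb_expect_add pb_expect_const using \<sigma>(2)
      by (simp add: power2_eq_square)
    also have "pb_expect p n (\<lambda>k. (real k - \<mu>) * (- f (w k)))
        = - (\<sigma> * pb_expect p n (\<lambda>k. w k * f (w k)))"
      using pb_expect_cmult[of p n "-1" "\<lambda>k. (real k - \<mu>) * f (w k)"] cov by simp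
    finally have "\<sigma> * pb_expect p n (\<lambda>k. of_bool (int k \<le> m - 1)) \<le> \<sigma> * (pb_expect p n R + Phi z)"
      by (simp add: algebra_simps)
    then show ?thesis
      using ER \<sigma>(2) unfolding z_def by simp
  qed
qed

text \<open>Rounding the threshold down to \<open>m\<close> keeps the event, and \<open>x\<close>
  lies between the standardised \<open>m\<close> and \<open>m + 1\<close>. The lattice bounds at
  these two points concern the same event; moving \<open>Phi\<close> to \<open>x\<close> costs
  another \<open>1 / \<sigma>\<close>.\<close>

theorem pb_berry_esseen:
  assumes p: "\<And>i. 0 \<le> p i \<and> p i \<le> 1"
    and \<mu>: "\<mu> = (\<Sum>i<n. p i)" and \<sigma>: "\<sigma>\<^sup>2 = (\<Sum>i<n. p i * (1 - p i))" "\<sigma> > 0"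
  shows "\<bar>pb_expect p n (\<lambda>k. of_bool (real k \<le> \<mu> + x * \<sigma>)) - Phi x\<bar> \<le> (3 + 1 / phi 1) / \<sigma>"
proof -
  define m where "m = \<lfloor>\<mu> + x * \<sigma>\<rfloor>"
  have iff: "real k \<le> \<mu> + x * \<sigma> \<longleftrightarrow> int k \<le> m" for k
    by (simp add: m_def le_floor_iff)
  have m: "of_int m \<le> \<mu> + x * \<sigma>" "\<mu> + x * \<sigma> < of_int m + 1"
    unfolding m_def by linarith+
  let ?z = "\<lambda>m. (of_int m - \<mu>) / \<sigma>"
  have z: "?z m \<le> x" "x \<le> ?z (m + 1)" "?z (m + 1) - ?z m = 1 / \<sigma>"
    using m \<sigma>(2) by (simp_all add: field_simps)
  have "Phi x - Phi (?z m) \<le> 1 / \<sigma>" "Phi (?z (m + 1)) - Phi x \<le> 1 / \<sigma>"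
    using Phi_diff_le[OF z(1)] Phi_diff_le[OF z(2)] z by linarith+
  moreover have "(3 + 1 / phi 1) / \<sigma> = (2 + 1 / phi 1) / \<sigma> + 1 / \<sigma>"
    by (simp add: add_divide_distrib)
  ultimately show ?thesis
    unfolding iff
    using pb_lattice_comparison(1)[OF p \<mu> \<sigma>, of m] pb_lattice_comparison(2)[OF p \<mu> \<sigma>, of "m + 1"]
    by simp
qed

section \<open>The polynomials \<open>P_n\<close>\<close>

text \<open>The product is the probability generating function; multiplying by one more factor is
  the recursion of \<open>pb_expect\<close>.\<close>

lemma coeff_prod_bernoulli:
  "coeff (\<Prod>i<n. [:1 - p i, p i:]) j = pb_expect p n (\<lambda>k. of_bool (k = j))"
proof (induction n arbitrary: j)
  case (Suc n)
  have "coeff (\<Prod>i<Suc n. [:1 - p i, p i:]) j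
      = (1 - p n) * coeff (\<Prod>i<n. [:1 - p i, p i:]) j
        + p n * (if j = 0 then 0 else coeff (\<Prod>i<n. [:1 - p i, p i:]) (j - 1))"
    by (cases j) (simp_all add: mult.commute[of _ "[:_, _:]"])
  also have "\<dots> = pb_expect p (Suc n) (\<lambda>k. of_bool (k = j))"
    by (cases j) (simp_all add: Suc.IH pb_expect_const)
  finally show ?case .
qed auto

lemma pb_expect_cong_le:
  assumes "\<And>k. k \<le> n \<Longrightarrow> F k = G k"
  shows "pb_expect p n F = pb_expect p n G"
  using assms
proof (induction n arbitrary: F G)
  case (Suc n)
  have "pb_expect p n F = pb_expect p n G"
    by (rule Suc.IH) (use Suc.prems in auto)
  moreover have "pb_expect p n (\<lambda>k. F (Suc k)) = pb_expect p n (\<lambda>k. G (Suc k))"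
    by (rule Suc.IH) (use Suc.prems in auto)
  ultimately show ?case by simp
qed auto

text \<open>\<open>P_h s (Suc n)\<close> is a multiple of X times the preceding partial sum, so
  adding it multiplies that sum by a linear factor.\<close>

lemma sum_P_h: "(\<Sum>k<Suc n. P_h s k) = (\<Prod>i<n. [:1, 1 / real (Suc i) powr s:])"
proof (induction n)
  case (Suc n)
  have "(\<Sum>k<Suc (Suc n). P_h s k) = (\<Sum>k<Suc n. P_h s k) + P_h s (Suc n)"
    by simp
  also have "P_h s (Suc n)
      = smult (1 / real (Suc n) powr s) (monom 1 1 * (\<Sum>k<Suc n. P_h s k))"
    by (subst P_h.simps) simp
  also have "(\<Sum>k<Suc n. P_h s k) + \<dots> = (\<Sum>k<Suc n. P_h s k) * [:1, 1 / real (Suc n) powr s:]"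
    by (simp add: monom_Suc algebra_simps del: sum.lessThan_Suc)
  finally show ?case by (simp add: Suc.IH del: sum.lessThan_Suc)
qed (simp add: P_h_0)

definition bern_prob :: "real \<Rightarrow> nat \<Rightarrow> real" where
  "bern_prob s i = 1 / (1 + real (Suc i) powr s)"

text \<open>Dividing each linear factor by its value at 1 makes it a Bernoulli generating function;
  the leading X shifts the law by 1.\<close>

lemma P_h_Suc:
  "P_h s (Suc n) = smult (poly (P_h s (Suc n)) 1)
      (pCons 0 (\<Prod>i<n. [:1 - bern_prob s i, bern_prob s i:]))"
proof -
  define c where "c = (\<Prod>i<n. 1 + 1 / real (Suc i) powr s)"
  have fac: "[:1, 1 / real (Suc i) powr s:]
      = smult (1 + 1 / real (Suc i) powr s) [:1 - bern_prob s i, bern_prob s i:]" for i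
  proof -
    have "[:1, 1 / t:] = smult (1 + 1 / t) [:1 - 1 / (1 + t), 1 / (1 + t):]" if "t > 0" for t :: real
    proof -
      have "1 + 1 / t = (1 + t) / t" "1 - 1 / (1 + t) = t / (1 + t)"
        using that by (simp_all add: field_simps)
      then show ?thesis using that by simp
    qed
    from this[of "real (Suc i) powr s"] show ?thesis
      unfolding bern_prob_def by simp
  qed
  have prod: "(\<Prod>i<n. [:1, 1 / real (Suc i) powr s:])
      = smult c (\<Prod>i<n. [:1 - bern_prob s i, bern_prob s i:])"
    unfolding c_def fac prod_smult ..
  have P: "P_h s (Suc n) = smult (c / real (Suc n) powr s)
      (pCons 0 (\<Prod>i<n. [:1 - bern_prob s i, bern_prob s i:]))"
    by (subst P_h.simps) (simp add: sum_P_h prod monom_Suc del: sum.lessThan_Suc of_nat_Suc)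
  \<comment> \<open>Generating functions are 1 at 1, which identifies the scalar.\<close>
  then have "poly (P_h s (Suc n)) 1 = c / real (Suc n) powr s"
    by (simp add: poly_prod)
  then show ?thesis
    using P by (simp only:)
qed

lemma poly_P_h_1_pos: "poly (P_h s n) 1 > 0"
proof (cases n)
  case (Suc m)
  have "poly (P_h s n) 1 = 1 / real n powr s * poly (\<Sum>k<Suc m. P_h s k) 1"
    unfolding Suc by (subst P_h.simps) (simp add: poly_monom del: sum.lessThan_Suc)
  also have "\<dots> > 0"
    unfolding sum_P_h poly_prod Suc
    by (intro mult_pos_pos prod_pos) (auto intro!: add_pos_nonneg)
  finally show ?thesis .
qed (simp add: P_h_0)

lemma coeff_sum_P_h:
  shows "1 / poly (P_h s (Suc n)) 1 * (\<Sum>k | k \<le> Suc n \<and> real k \<le> y. A_coeff (Suc n) k s)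
    = pb_expect (bern_prob s) n (\<lambda>k. of_bool (real (Suc k) \<le> y))"
proof -
  let ?Q = "\<Prod>i<n. [:1 - bern_prob s i, bern_prob s i:]"
  have A: "1 / poly (P_h s (Suc n)) 1 * A_coeff (Suc n) k s = coeff (pCons 0 ?Q) k" for k
  proof -
    have "A_coeff (Suc n) k s = poly (P_h s (Suc n)) 1 * coeff (pCons 0 ?Q) k"
      unfolding A_coeff_def coeff_smult[symmetric] P_h_Suc[symmetric] ..
    then show ?thesis
      using poly_P_h_1_pos[of s "Suc n"] by simp
  qed
  \<comment> \<open>An expectation is recovered from the point masses, as the values do not exceed
    \<open>n\<close>.\<close>
  have total: "pb_expect (bern_prob s) n F = (\<Sum>j\<le>n. coeff ?Q j * F j)" for F
  proof -
    have "(\<Sum>j\<le>n. coeff ?Q j * F j) = pb_expect (bern_prob s) n (\<lambda>k. \<Sum>j\<le>n. F j * of_bool (k = j))"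
      unfolding pb_expect_sum coeff_prod_bernoulli pb_expect_cmult by (simp add: mult.commute)
    also have "\<dots> = pb_expect (bern_prob s) n F"
      by (rule pb_expect_cong_le) (simp add: of_bool_def if_distrib cong: if_cong)
    finally show ?thesis ..
  qed
  have "1 / poly (P_h s (Suc n)) 1 * (\<Sum>k | k \<le> Suc n \<and> real k \<le> y. A_coeff (Suc n) k s)
      = (\<Sum>k | k \<le> Suc n \<and> real k \<le> y. coeff (pCons 0 ?Q) k)"
    unfolding sum_distrib_left A ..
  also have "\<dots> = (\<Sum>k\<le>Suc n. coeff (pCons 0 ?Q) k * of_bool (real k \<le> y))"
    by (intro sum.mono_neutral_cong_left) auto
  \<comment> \<open>The constant coefficient is 0; the index shift produces \<open>Suc k\<close> in
    the event.\<close>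
  also have "\<dots> = (\<Sum>k\<le>n. coeff ?Q k * of_bool (real (Suc k) \<le> y))"
    by (subst sum.atMost_Suc_shift) simp
  finally show ?thesis
    unfolding total .
qed

text \<open>With \<open>t = k powr s\<close>, \<open>0 \<le> s\<close> gives
  \<open>1 \<le> t\<close>, so the summand is at least \<open>1 / (4 * t)\<close>, and
  \<open>s \<le> 1\<close> gives \<open>t \<le> k\<close>. The harmonic series then forces
  divergence.\<close>

lemma filterlim_sigma_h:
  assumes "0 \<le> s" and "s \<le> 1"
  shows "filterlim (\<lambda>n. sigma_h n s) at_top sequentially"
proof -
  have "1 / 4 * (1 / real k) \<le> real k powr s / (1 + real k powr s)\<^sup>2" if "k \<ge> 1" for k
  proof -
    have 1: "1 \<le> real k powr s"
      using that assms by (simp add: ge_one_powr_ge_zero)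
    have 2: "real k powr s \<le> real k"
      using that assms powr_mono[of s 1 "real k"] by simp
    have "1 / 4 * (1 / real k) \<le> 1 / 4 * (1 / real k powr s)"
      using 1 2 that by (intro mult_left_mono frac_le) auto
    also have "\<dots> = real k powr s / (2 * real k powr s)\<^sup>2"
      using 1 by (simp add: power2_eq_square)
    also have "\<dots> \<le> real k powr s / (1 + real k powr s)\<^sup>2"
      using 1 that by (intro divide_left_mono power_mono mult_pos_pos zero_less_power) auto
    finally show ?thesis .
  qed
  then have le: "1 / 4 * harm n \<le> (\<Sum>k=1..<Suc n. real k powr s / (1 + real k powr s)\<^sup>2)" for n
    unfolding harm_def sum_distrib_left atLeastLessThanSuc_atLeastAtMost
    by (intro sum_mono) (simp add: inverse_eq_divide)
  have "filterlim (\<lambda>n. 1 / 4 * harm n :: real) at_top sequentially"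
    by (rule filterlim_tendsto_pos_mult_at_top[OF tendsto_const _ harm_at_top]) simp
  then have "filterlim (\<lambda>n. \<Sum>k=1..<Suc n. real k powr s / (1 + real k powr s)\<^sup>2) at_top sequentially"
    by (rule filterlim_at_top_mono) (use le in auto)
  then have "filterlim (\<lambda>n. sigma_h (Suc n) s) at_top sequentially"
    unfolding sigma_h_def by (rule filterlim_compose[OF sqrt_at_top])
  then show ?thesis
    using filterlim_sequentially_Suc[of "\<lambda>n. sigma_h n s" at_top] by simp
qed

lemma P_h_berry_esseen:
  assumes "n \<ge> 2"
  shows "\<bar>1 / poly (P_h s n) 1
           * (\<Sum>k | k \<le> n \<and> real k \<le> mu_h n s + x * sigma_h n s. A_coeff n k s) - Phi x\<bar>
    \<le> (3 + 1 / phi 1) / sigma_h n s"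
proof -
  obtain N where N: "n = Suc N" "N \<ge> 1"
    using assms by (cases n) auto
  define p where "p = bern_prob s"
  have pos: "1 + real (Suc i) powr s > 0" for i
    by (simp add: add_pos_nonneg)
  have p: "0 \<le> p i \<and> p i \<le> 1" for i
    using pos[of i] by (simp add: p_def bern_prob_def)
  have shift: "(\<Sum>k=1..<n. g k) = (\<Sum>i<N. g (Suc i))" for g :: "nat \<Rightarrow> real"
    unfolding N atLeastLessThanSuc_atLeastAtMost by (simp add: sum.atLeast1_atMost_eq)
  have var: "p i * (1 - p i) = real (Suc i) powr s / (1 + real (Suc i) powr s)\<^sup>2" for i
    unfolding p_def bern_prob_def using pos[of i] by (simp add: field_simps power2_eq_square)
  have mu: "mu_h n s = 1 + (\<Sum>i<N. p i)"
    unfolding mu_h_def shift p_def bern_prob_def ..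
  \<comment> \<open>\<open>n \<ge> 2\<close> makes this sum nonempty.\<close>
  have "(\<Sum>i<N. p i * (1 - p i)) > 0"
    unfolding var using N(2) pos
    by (intro sum_pos divide_pos_pos zero_less_power) (auto simp: lessThan_empty_iff)
  then have sigma: "(sigma_h n s)\<^sup>2 = (\<Sum>i<N. p i * (1 - p i))" "sigma_h n s > 0"
    unfolding sigma_h_def shift var by auto
  have "1 / poly (P_h s n) 1
      * (\<Sum>k | k \<le> n \<and> real k \<le> mu_h n s + x * sigma_h n s. A_coeff n k s)
      = pb_expect p N (\<lambda>k. of_bool (real k \<le> (\<Sum>i<N. p i) + x * sigma_h n s))"
    unfolding N(1) coeff_sum_P_h unfolding N(1)[symmetric] mu p_def[symmetric]
    by (simp add: algebra_simps)
  then show ?thesis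
    using pb_berry_esseen[OF p refl sigma] by simp
qed

theorem theorem2:
  fixes s :: real
  assumes "0 \<le> s" and "s \<le> 1"
  shows "(\<exists>C::real. C > 0 \<and> (\<forall>n::nat. n \<ge> 2 \<longrightarrow>
            (SUP x::real. ereal \<bar>1 / poly (P_h s n) 1
                 * (\<Sum>k | k \<le> n \<and> real k \<le> mu_h n s + x * sigma_h n s. A_coeff n k s)
               - 1 / sqrt (2 * pi) * (LBINT t:{..x}. exp (- (t\<^sup>2) / 2))\<bar>)
            \<le> ereal (C / sigma_h n s)))
       \<and> filterlim (\<lambda>n. sigma_h n s) at_top sequentially"
\<comment> \<open>The constant is \<open>2 + 1 / phi 1\<close> from the lattice comparison plus 1
  from rounding; being free of \<open>x\<close>, it bounds the supremum.\<close>
proof (intro conjI exI[of _ "3 + 1 / phi 1"] allI impI SUP_least)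
  show "3 + 1 / phi 1 > 0"
    using std_normal_density_pos[of 1] by (simp add: add_pos_pos)
  show "filterlim (\<lambda>n. sigma_h n s) at_top sequentially"
    using assms by (rule filterlim_sigma_h)
qed (simp only: Phi_eq_exp_integral[symmetric] ereal_less_eq P_h_berry_esseen)

end
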